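(* Let $B\in\{1,\dots,9\}$, let $\tilde p\neq0$ be an integer and $\tilde q$ a positive integer with $\tilde q\geqslant 7\sqrt[3]{|\tilde p|}$. Put $F_3=B\tilde q^{4}-\tilde p\tilde q+\frac{16}{B}$. Then the equation $\tilde Q(t)=0$ has at least one real root $t$ with $F_3+\frac{32\tilde p}{B^{2}\tilde q^{3}}<t<F_3$ if $\tilde p<0$, respectively with $F_3<t<F_3+\frac{32\tilde p}{B^{2}\tilde q^{3}}$ if $\tilde p>0$.
   Context: For numbers $p,q$ let $$Q_{pq}(t)=t^{10}+(2q^{2}+p^{2})(3q^{2}-2p^{2})\,t^{8}+(q^{8}+10p^{2}q^{6}+4p^{4}q^{4}-14p^{6}q^{2}+p^{8})\,t^{6}-p^{2}q^{2}(q^{8}-14p^{2}q^{6}+4p^{4}q^{4}+10p^{6}q^{2}+p^{8})\,t^{4}-p^{6}q^{6}(q^{2}+2p^{2})(3p^{2}-2q^{2})\,t^{2}-q^{10}p^{10}.$$ Given $B$, $\tilde p$, $\tilde q$, define $\tilde Q(t)=Q_{pq}(t)$ with $p=B\tilde q^{3}-\tilde p$ and $q=\tilde q$. *)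

theory Defs
  imports Complex_Main
begin

definition Qpq :: "real \<Rightarrow> real \<Rightarrow> real \<Rightarrow> real" where
  "Qpq p q t =
     t^10
     + (2*q^2 + p^2) * (3*q^2 - 2*p^2) * t^8
     + (q^8 + 10*p^2*q^6 + 4*p^4*q^4 - 14*p^6*q^2 + p^8) * t^6
     - p^2*q^2 * (q^8 - 14*p^2*q^6 + 4*p^4*q^4 + 10*p^6*q^2 + p^8) * t^4
     - p^6*q^6 * (q^2 + 2*p^2) * (3*p^2 - 2*q^2) * t^2
     - q^10*p^10"

definition Q_tilde :: "real \<Rightarrow> real \<Rightarrow> real \<Rightarrow> real \<Rightarrow> real" where
  "Q_tilde B pt qt t = Qpq (B * qt^3 - pt) qt t"

definition F3 :: "real \<Rightarrow> real \<Rightarrow> real \<Rightarrow> real" where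
  "F3 B pt qt = B * qt^4 - pt * qt + 16 / B"

end

theory Submission
  imports Defs
begin

text \<open>
  With \<open>w = q\<^sup>2/p\<^sup>2\<close> and \<open>t = p q (1 + w y)\<close>, homogeneity turns \<open>Q\<^sub>p\<^sub>q(t)\<close> into a positive
  multiple of \<open>2 (y - 16) + w S(w,y)\<close>, where \<open>-170 \<le> S < 0\<close> for small \<open>w\<close> and \<open>y\<close> near \<open>16\<close>.
  Writing \<open>e = pt/(B qt\<^sup>3)\<close>, the two ends of the interval are \<open>y = 16 (1 - e)\<close> and
  \<open>y = 16 (1 - e) (1 + 2 e)\<close>, so \<open>y - 16\<close> is about \<open>\<mp>16 e\<close>. As \<open>w\<close> is at most about
  \<open>\<bar>e\<bar>/7\<close>, the first term decides the signs at the ends and the intermediate value theorem applies.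
\<close>

text \<open>Grouped by powers of the small parameter \<open>w\<close>. The term of order zero
  vanishes at \<open>v = 1\<close>, and the bracket multiplying \<open>-w\<close> equals 32 there,
  which is twice the 16 around which \<open>y\<close> varies.\<close>

definition reduced_poly :: "real \<Rightarrow> real \<Rightarrow> real" where
  "reduced_poly w v =
     v^3 - v^2 - w * (2*v^4 + 14*v^3 + 10*v^2 + 6*v) + w^2 * ((v - 1) * (v^4 + 4*v^2 + 1))
     + w^3 * (6*v^4 + 10*v^3 + 14*v^2 + 2*v) + w^4 * (v^3 - v^2)"

text \<open>\<open>Qpq\<close> is homogeneous of degree 20 if \<open>p\<close> and \<open>q\<close>
  have weight 1 and \<open>t\<close> has weight 2, so only the ratio of \<open>q\<close> to
  \<open>p\<close> survives; the lowest power of \<open>q\<close> left is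
  \<open>q^6\<close>.\<close>

lemma Qpq_eq_reduced_poly:
  assumes "p \<noteq> 0"
  shows "Qpq p q (p * q * s) = p^14 * q^6 * reduced_poly (q^2 / p^2) (s^2)"
proof -
  define r where "r = q / p"
  have q: "q = r * p" and w: "q^2 / p^2 = r^2"
    using assms by (simp_all add: r_def power_divide)
  show ?thesis
    unfolding w unfolding q Qpq_def reduced_poly_def by algebra
qed

text \<open>Expanding at \<open>v = 1\<close> in \<open>z = v - 1 = w * x\<close> gives
  \<open>w * (x - 32 + w * S)\<close> with \<open>S\<close> bounded, and \<open>x\<close> differs
  from \<open>2 * y\<close> only by \<open>w * y^2\<close>.\<close>

lemma reduced_poly_bounds:
  assumes w: "0 < w" "w \<le> 1/2000" and y: "159/10 \<le> y" "y \<le> 161/10"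
  shows "reduced_poly w ((1 + w*y)^2) < w * (2 * (y - 16))"
    and "reduced_poly w ((1 + w*y)^2) \<ge> w * (2 * (y - 16) - 170 * w)"
proof -
  define x where "x = 2*y + w*y^2"
  define z where "z = w*x"
  define v where "v = 1 + z"
  have v_eq: "(1 + w*y)^2 = v"
    unfolding v_def z_def x_def by algebra
  have y2: "252 \<le> y^2" "y^2 \<le> 260"
    using power_mono[OF y(1), of 2] power_mono[OF y(2), of 2] y by (simp_all add: power2_eq_square)
  have wy2: "0 \<le> w * y^2" "w * y^2 \<le> 1/2000 * 260" "w * 252 \<le> w * y^2" "w * y^2 \<le> w * 260"
    using w y2 mult_mono[OF w(2) y2(2)] by simp_all
  have x: "318/10 \<le> x" "x \<le> 324/10" "2*y + 252*w \<le> x" "x \<le> 2*y + 260*w"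
    using wy2 y by (simp_all add: x_def)
  have z: "0 < z" "z \<le> 17/1000"
    using mult_mono[OF w(2) x(2)] w x by (simp_all add: z_def)
  have v: "1 \<le> v" "v \<le> 1017/1000"
    using z by (simp_all add: v_def)
  \<comment> \<open>Second-order part: 76 is the derivative at \<open>v = 1\<close> of the bracket
    multiplying \<open>-w\<close>, and \<open>2*x\<close> comes from
    \<open>v^3 - v^2 = z + 2*z^2 + z^3\<close>.\<close>
  have "x * (76 - 2*x) \<ge> 318/10 * (112/10)" "x * (76 - 2*x) \<le> 324/10 * (124/10)"
    using x by (intro mult_mono; simp)+
  then have q: "356 \<le> x * (76 - 2*x)" "x * (76 - 2*x) \<le> 402"
    by simp_all
  have "x^2 \<le> 1050"
    using power_mono[OF x(2), of 2] x by (simp add: power2_eq_square)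
  then have "w * x^2 \<le> 1/2000 * 1050"
    using w by (intro mult_mono) simp_all
  then have wx2: "0 \<le> w * x^2" "w * x^2 \<le> 525/1000"
    using w by simp_all
  \<comment> \<open>Collects the remaining Taylor terms of the same two polynomials: 64, 22 and 2
    are the coefficients of \<open>z^2\<close>, \<open>z^3\<close>, \<open>z^4\<close> in the
    bracket, and \<open>x\<close> stems from \<open>z^3\<close>.\<close>
  define h where "h = (64 - x) + 22*z + 2*z^2"
  have "z^2 \<le> 1"
    using z by (simp add: power_le_one)
  then have h: "0 \<le> h" "h \<le> 36"
    using x z by (simp_all add: h_def)
  have hw: "0 \<le> (w * x^2) * h" "(w * x^2) * h \<le> 19"
    using mult_mono[OF wx2(2) h(2)] wx2 h by simp_all
  have vk: "1 \<le> v^n" "v^n \<le> (1017/1000)^n" for n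
    using v by (simp_all add: power_mono)
  have v2: "v^2 \<le> 2" and v3: "v^3 \<le> 2" and v4: "v^4 \<le> 2"
    using vk(2)[of 2] vk(2)[of 3] vk(2)[of 4] by (simp_all add: power_divide)
  define b where "b = z * (v^4 + 4*v^2 + 1)"
  have "b \<le> 17/1000 * 11"
    unfolding b_def using z v2 v4 vk(1)[of 2] vk(1)[of 4] by (intro mult_mono) simp_all
  moreover have "0 \<le> b"
    using z v by (simp add: b_def)
  ultimately have b: "0 \<le> b" "b \<le> 1"
    by simp_all
  define c where "c = 6*v^4 + 10*v^3 + 14*v^2 + 2*v"
  have c: "0 \<le> c" "c \<le> 100"
    using v v2 v3 v4 by (simp_all add: c_def)
  have wc: "0 \<le> w * c" "w * c \<le> 1"
    using mult_mono[OF w(2) c(2)] w c by simp_all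
  define d where "d = v^3 - v^2"
  have d: "0 \<le> d" "d \<le> 2"
    unfolding d_def using v v3 power_increasing[of 2 3 v] vk(1)[of 2] by linarith+
  have "w^2 \<le> 1"
    using w by (simp add: power_le_one)
  then have wd: "0 \<le> w^2 * d" "w^2 * d \<le> 2"
    using mult_mono[of "w^2" 1 d 2] d by simp_all
  define S where "S = b + w * c + w^2 * d - x * (76 - 2*x) - (w * x^2) * h"
  \<comment> \<open>This \<open>S\<close> is the one of the overview minus \<open>y^2\<close>. As
    \<open>y^2\<close> lies between 252 and 260, the bounds -422 and -260 become -170 and 0.\<close>
  have S: "S < -260" "S > -422"
    using b wc wd q hw by (simp_all add: S_def)
  have eq: "reduced_poly w v = w * (x - 32 + w * S)"
    unfolding reduced_poly_def S_def b_def c_def d_def h_def v_def z_def by algebra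
  have "w * S < w * (-260)" "w * S > w * (-422)"
    using S w by (simp_all only: mult_strict_left_mono)
  then have "x - 32 + w * S < 2 * (y - 16)" "x - 32 + w * S \<ge> 2 * (y - 16) - 170 * w"
    using x by simp_all
  then show "reduced_poly w ((1 + w*y)^2) < w * (2 * (y - 16))"
    and "reduced_poly w ((1 + w*y)^2) \<ge> w * (2 * (y - 16) - 170 * w)"
    unfolding v_eq eq using w by simp_all
qed

text \<open>The two conditions are asymmetric because the correction to \<open>2 * (y - 16)\<close>
  is negative: it helps for \<open>y \<le> 16\<close> and has to be outweighed beyond 16.\<close>

lemma Qpq_sign:
  assumes "0 < p" "0 < q" and w: "q^2 / p^2 \<le> 1/2000" and y: "159/10 \<le> y" "y \<le> 161/10"
  shows "y \<le> 16 \<Longrightarrow> Qpq p q (p * q * (1 + q^2 / p^2 * y)) < 0"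
    and "170 * (q^2 / p^2) < 2 * (y - 16) \<Longrightarrow> 0 < Qpq p q (p * q * (1 + q^2 / p^2 * y))"
proof -
  define w where "w = q^2 / p^2"
  have w0: "0 < w"
    using assms by (simp add: w_def)
  note bounds = reduced_poly_bounds[OF w0 w[folded w_def] y]
  have Q: "Qpq p q (p * q * (1 + w * y)) = p^14 * q^6 * reduced_poly w ((1 + w*y)^2)"
    using Qpq_eq_reduced_poly[of p q] assms by (simp add: w_def)
  have pq: "0 < p^14 * q^6"
    using assms by simp
  show "Qpq p q (p * q * (1 + q^2 / p^2 * y)) < 0" if "y \<le> 16"
  proof -
    have "w * (2 * (y - 16)) \<le> 0"
      using that w0 by (simp add: mult_nonneg_nonpos)
    then show ?thesis
      using bounds(1) pq unfolding w_def[symmetric] Q by (intro mult_pos_neg) simp_all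
  qed
  show "0 < Qpq p q (p * q * (1 + q^2 / p^2 * y))" if "170 * (q^2 / p^2) < 2 * (y - 16)"
  proof -
    have "0 < w * (2 * (y - 16) - 170 * w)"
      using that w0 unfolding w_def[symmetric] by (intro mult_pos_pos) simp_all
    then show ?thesis
      using bounds(2) unfolding w_def[symmetric] Q by (intro mult_pos_pos[OF pq]) simp
  qed
qed

lemma isCont_Q_tilde: "isCont (Q_tilde b u q) t"
  unfolding Q_tilde_def Qpq_def by (intro continuous_intros)

lemma Q_tilde_signs:
  fixes b u q :: real
  defines "l \<equiv> F3 b u q" and "r \<equiv> F3 b u q + 32 * u / (b^2 * q^3)"
  assumes b: "1 \<le> b" and q: "7 \<le> q" and u: "1 \<le> \<bar>u\<bar>" and uq: "343 * \<bar>u\<bar> \<le> q^3"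
  shows "0 < u \<Longrightarrow> Q_tilde b u q l < 0 \<and> 0 < Q_tilde b u q r"
    and "u < 0 \<Longrightarrow> Q_tilde b u q r < 0 \<and> 0 < Q_tilde b u q l"
proof -
  define e where "e = u / (b * q^3)"
  define p where "p = b * q^3 - u"
  define w where "w = q^2 / p^2"
  have bq: "0 < b * q^3"
    using b q by simp
  have "1 * q^3 \<le> b * q^3"
    using b q by (intro mult_right_mono) simp_all
  then have "343 * \<bar>u\<bar> \<le> b * q^3"
    using uq by simp
  then have e: "\<bar>e\<bar> \<le> 1/343"
    using bq by (simp add: e_def abs_divide field_simps)
  then have e1: "e \<noteq> 1"
    by auto
  have p_eq: "p = b * q^3 * (1 - e)"
    using b q by (simp add: p_def e_def field_simps)
  have p0: "0 < p"
    unfolding p_eq using e by (intro mult_pos_pos[OF bq]) simp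
  have "(342/343)^2 \<le> (1 - e)^2"
    using e by (intro power_mono) simp_all
  then have e2: "99/100 \<le> (1 - e)^2"
    by (simp add: power_divide)
  have "w = q^2 / ((b * q^3)^2 * (1 - e)^2)"
    by (simp add: w_def p_eq power_mult_distrib)
  also have "\<dots> = 1 / (b^2 * q^4 * (1 - e)^2)"
    using q by (simp add: power_mult_distrib divide_simps flip: power_add power_mult)
  finally have w_eq: "w = 1 / (b^2 * q^4 * (1 - e)^2)" .
  have "1 * 7^4 * (99/100) \<le> b^2 * q^4 * (1 - e)^2"
    using b q e2 by (intro mult_mono power_mono one_le_power) simp_all
  then have "2000 \<le> b^2 * q^4 * (1 - e)^2"
    by simp
  then have w: "w \<le> 1/2000"
    unfolding w_eq by (intro divide_left_mono) simp_all
  \<comment> \<open>The quotient of \<open>w\<close> by \<open>\<bar>e\<bar>\<close> is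
    \<open>1 / (b * q * (1 - e)^2 * \<bar>u\<bar>)\<close>, below 1/6. Taking 31 instead of 32
    leaves room for the term \<open>64 * e^2\<close> in \<open>2 * (y2 - 16)\<close>.\<close>
  have w_e: "170 * w < 31 * \<bar>e\<bar>"
  proof -
    have "1 * 7 * (99/100) \<le> b * q * (1 - e)^2"
      using b q e2 by (intro mult_mono) simp_all
    then have "170 < 31 * (b * q * (1 - e)^2)"
      by simp
    also have "\<dots> \<le> 31 * (b * q * (1 - e)^2) * \<bar>u\<bar>"
      using u b q mult_left_mono[OF u, of "31 * (b * q * (1 - e)^2)"] by simp
    finally have *: "170 < 31 * (b * q * (1 - e)^2) * \<bar>u\<bar>" .
    have D: "0 < b^2 * q^4 * (1 - e)^2"
      using b q e1 by simp
    have "170 * w = 170 / (b^2 * q^4 * (1 - e)^2)"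
      by (simp add: w_eq)
    also have "\<dots> < 31 * (b * q * (1 - e)^2) * \<bar>u\<bar> / (b^2 * q^4 * (1 - e)^2)"
      using * D by (intro divide_strict_right_mono)
    also have "\<dots> = 31 * (\<bar>u\<bar> / (b * q^3))"
      using b q e1 by (simp add: divide_simps power2_eq_square power4_eq_xxxx power3_eq_cube)
    also have "\<dots> = 31 * \<bar>e\<bar>"
      using bq by (simp add: e_def abs_divide)
    finally show ?thesis .
  qed
  \<comment> \<open>Since \<open>p * q * w = 1 / (b * (1 - e))\<close>, the factor
    \<open>1 - e\<close> in \<open>y1\<close> and in \<open>y2 = 16 * (1 - e) * (1 + 2*e)\<close>
    cancels, so the interval ends are hit exactly.\<close>
  define y1 where "y1 = 16 * (1 - e)"
  define y2 where "y2 = 16 * (1 + e - 2 * e^2)"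
  have key: "p * q * (w * y) = y / b / (1 - e)" for y
    using b q e1 unfolding w_eq p_eq
    by (simp add: divide_simps power2_eq_square power4_eq_xxxx power3_eq_cube)
  have l: "l = p * q * (1 + w * y1)"
  proof -
    have "p * q * (w * y1) = 16 / b"
      unfolding key y1_def using e1 b by (simp add: field_simps)
    then show ?thesis
      by (simp add: l_def F3_def p_def distrib_left algebra_simps power3_eq_cube power4_eq_xxxx)
  qed
  have r: "r = p * q * (1 + w * y2)"
  proof -
    have y2: "y2 = 16 * (1 + 2*e) * (1 - e)"
      by (simp add: y2_def algebra_simps power2_eq_square)
    have "p * q * (w * y2) = 16 * (1 + 2*e) / b"
      unfolding key y2 using e1 b by (simp add: field_simps)
    also have "\<dots> = 16 / b + 32 * u / (b^2 * q^3)"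
      using b q by (simp add: e_def field_simps power2_eq_square)
    finally show ?thesis
      by (simp add: r_def F3_def p_def distrib_left algebra_simps power3_eq_cube power4_eq_xxxx)
  qed
  \<comment> \<open>With the square as an atom, the remaining inequalities are linear in
    \<open>e\<close>, \<open>s\<close> and \<open>\<bar>e\<bar>\<close>.\<close>
  define s where "s = e^2"
  have y2_alt: "y2 = 16 * (1 + e - 2 * s)"
    by (simp add: y2_def s_def)
  have ee: "0 \<le> s" "s \<le> \<bar>e\<bar> / 343"
    using mult_left_mono[OF e, of "\<bar>e\<bar>"] by (simp_all add: s_def power2_eq_square abs_mult[symmetric])
  have y1: "159/10 \<le> y1" "y1 \<le> 161/10" and y2: "159/10 \<le> y2" "y2 \<le> 161/10"
    using e ee by (simp_all add: y1_def y2_alt)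
  have q0: "0 < q"
    using q by simp
  note sgn1 = Qpq_sign[OF p0 q0 w[unfolded w_def] y1, folded w_def, folded l]
  note sgn2 = Qpq_sign[OF p0 q0 w[unfolded w_def] y2, folded w_def, folded r]
  have Q: "Q_tilde b u q t = Qpq p q t" for t
    by (simp add: Q_tilde_def p_def)
  show "Q_tilde b u q l < 0 \<and> 0 < Q_tilde b u q r" if "0 < u"
  proof -
    have "0 < e"
      using that bq by (simp add: e_def)
    then show ?thesis
      unfolding Q using w_e ee e by (intro conjI sgn1 sgn2) (simp_all add: y1_def y2_alt)
  qed
  show "Q_tilde b u q r < 0 \<and> 0 < Q_tilde b u q l" if "u < 0"
  proof -
    have "e < 0"
      using that bq by (simp add: e_def divide_neg_pos)
    then show ?thesis
      unfolding Q using w_e ee e by (intro conjI sgn1 sgn2) (simp_all add: y1_def y2_alt)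
  qed
qed

lemma IVT_strict:
  fixes f :: "real \<Rightarrow> real"
  assumes "f a < 0" "0 < f b" "a \<le> b" "\<And>t. isCont f t"
  shows "\<exists>t. f t = 0 \<and> a < t \<and> t < b"
  using IVT[of f a 0 b] assms by (metis less_eq_real_def less_irrefl)

theorem theorem4p3:
  fixes B pt qt :: int
  assumes "B \<in> {1..9}"
    and "pt \<noteq> 0"
    and "qt > 0"
    and "real_of_int qt \<ge> 7 * root 3 \<bar>real_of_int pt\<bar>"
  shows "(pt < 0 \<longrightarrow> (\<exists>t::real. Q_tilde (real_of_int B) (real_of_int pt) (real_of_int qt) t = 0
            \<and> F3 (real_of_int B) (real_of_int pt) (real_of_int qt)
                + 32 * real_of_int pt / ((real_of_int B)^2 * (real_of_int qt)^3) < t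
            \<and> t < F3 (real_of_int B) (real_of_int pt) (real_of_int qt)))
       \<and> (pt > 0 \<longrightarrow> (\<exists>t::real. Q_tilde (real_of_int B) (real_of_int pt) (real_of_int qt) t = 0
            \<and> F3 (real_of_int B) (real_of_int pt) (real_of_int qt) < t
            \<and> t < F3 (real_of_int B) (real_of_int pt) (real_of_int qt)
                + 32 * real_of_int pt / ((real_of_int B)^2 * (real_of_int qt)^3)))"
proof -
  define b u q where "b = real_of_int B" and "u = real_of_int pt" and "q = real_of_int qt"
  have b: "1 \<le> b"
    using assms(1) by (simp add: b_def)
  \<comment> \<open>Integrality of \<open>pt\<close> enters here; it makes the cube root at least 1
    and so forces \<open>7 \<le> q\<close>.\<close>
  have u: "1 \<le> \<bar>u\<bar>"
    using assms(2) by (simp add: u_def)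
  have root_le: "7 * root 3 \<bar>u\<bar> \<le> q"
    using assms(4) by (simp add: u_def q_def)
  have "1 \<le> root 3 \<bar>u\<bar>"
    using u by simp
  then have q: "7 \<le> q"
    using root_le by linarith
  have "(7 * root 3 \<bar>u\<bar>)^3 \<le> q^3"
    using root_le by (intro power_mono) simp_all
  then have uq: "343 * \<bar>u\<bar> \<le> q^3"
    by (simp add: power_mult_distrib)
  note signs = Q_tilde_signs[OF b q u uq]
  have D: "0 < b^2 * q^3"
    using b q by simp
  have neg: "\<exists>t. Q_tilde b u q t = 0 \<and> F3 b u q + 32 * u / (b^2 * q^3) < t \<and> t < F3 b u q"
    if "u < 0"
  proof (rule IVT_strict)
    show "F3 b u q + 32 * u / (b^2 * q^3) \<le> F3 b u q"
      using that D by (simp add: divide_nonpos_pos)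
  qed (use signs(2) that isCont_Q_tilde in blast)+
  have pos: "\<exists>t. Q_tilde b u q t = 0 \<and> F3 b u q < t \<and> t < F3 b u q + 32 * u / (b^2 * q^3)"
    if "0 < u"
  proof (rule IVT_strict)
    show "F3 b u q \<le> F3 b u q + 32 * u / (b^2 * q^3)"
      using that D by simp
  qed (use signs(1) that isCont_Q_tilde in blast)+
  show ?thesis
    using neg pos by (simp add: b_def u_def q_def)
qed

end
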